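(* Let $a$ and $x$ be real numbers and $m$ a positive integer. Then for all $z$ in a sufficiently small neighbourhood of $0$ (depending on $a$, $m$ and $x$), $$\sum_{n=0}^{\infty}\widetilde{F}_{m,a}(n;x)\frac{z^n}{n!}=\int_{0}^{\infty}\exp\left[-az-\lambda\left(1-\frac{x}{m}\left(e^{mz}-1\right)\right)\right]d\lambda.$$
   Context: For a real number $a$, a positive integer $m$ and integers $n,k\ge 0$, the noncentral Whitney numbers of the second kind are given by $$\widetilde{W}_{m,a}(n,k)=\frac{1}{m^k k!}\sum_{j=0}^{k}\binom{k}{j}(-1)^{k-j}(mj-a)^n,$$ with the convention $0^0=1$. The noncentral Tanny-Dowling polynomials are $$\widetilde{F}_{m,a}(n;x)=\sum_{k=0}^{n}k!\,\widetilde{W}_{m,a}(n,k)\,x^k.$$ *)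

theory Defs
  imports "HOL-Analysis.Analysis"
begin

definition noncentral_whitney2 :: "nat \<Rightarrow> real \<Rightarrow> nat \<Rightarrow> nat \<Rightarrow> real" where
  "noncentral_whitney2 m a n k =
     1 / (real m ^ k * fact k) *
     (\<Sum>j=0..k. real (k choose j) * (-1) ^ (k - j) * (real m * real j - a) ^ n)"

definition noncentral_tanny_dowling :: "nat \<Rightarrow> real \<Rightarrow> nat \<Rightarrow> real \<Rightarrow> real" where
  "noncentral_tanny_dowling m a n x =
     (\<Sum>k=0..n. fact k * noncentral_whitney2 m a n k * x ^ k)"

end

theory Submission
  imports Defs
begin

text \<open>
  The coefficient identity behind the theorem holds for formal power series: with
  \<open>E = exp(-a z)\<close> and \<open>U = (x/m) (exp(m z) - 1)\<close>, the summand \<open>k! W(n,k) x^k / n!\<close> is the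
  \<open>n\<close>-th coefficient of \<open>E U^k\<close>. Since \<open>U\<close> has no constant term, only the terms \<open>k \<le> n\<close> of the
  geometric series \<open>E / (1 - U) = \<Sum>k. E U^k\<close> contribute to the \<open>n\<close>-th coefficient. Near \<open>0\<close>
  this quotient represents \<open>exp(-a z) / (1 - U z)\<close>, where the real part of \<open>1 - U z\<close> is positive,
  so that \<open>1 / (1 - U z)\<close> is the Laplace integral of \<open>exp(-l (1 - U z))\<close> over \<open>l \<ge> 0\<close>.
\<close>

unbundle fps_syntax

text \<open>A finite geometric sum stands in for the infinite one: it telescopes to
  \<open>G * (1 - U ^ Suc n)\<close> for the quotient \<open>G\<close>, and \<open>U ^ Suc n\<close>
  has no terms of degree at most \<open>n\<close>.\<close>

lemma fps_nth_divide_one_minus: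
  fixes E U :: "'a :: field fps"
  assumes "U $ 0 = 0"
  shows "(E / (1 - U)) $ n = (\<Sum>k\<le>n. (E * U ^ k) $ n)"
proof -
  define G where "G = E / (1 - U)"
  have unit: "(1 - U) $ 0 \<noteq> 0"
    using assms by simp
  have E: "E = G * (1 - U)"
    by (simp only: G_def fps_divide_unit[OF unit] mult.assoc inverse_mult_eq_1[OF unit] mult_1_right)
  have "(\<Sum>k\<le>n. E * U ^ k) = G * (1 - U ^ Suc n)"
    unfolding one_diff_power_eq lessThan_Suc_atMost
    by (simp add: E sum_distrib_left mult.assoc)
  hence "(\<Sum>k\<le>n. (E * U ^ k) $ n) = (G * (1 - U ^ Suc n)) $ n"
    by (metis fps_sum_nth)
  also have "\<dots> = G $ n - (G * U ^ Suc n) $ n"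
    by (simp only: right_diff_distrib fps_sub_nth mult_1_right)
  also have "(G * U ^ Suc n) $ n = 0"
    using startsby_zero_power_prefix[OF assms, of "Suc n"] unfolding fps_mult_nth
    by (intro sum.neutral) (auto simp del: power_Suc)
  finally show ?thesis
    by (simp add: G_def)
qed

text \<open>Binomial expansion of the power leaves a combination of pure exponentials. For
  \<open>b = -a\<close> and \<open>c = m\<close> the sum on the right is the one defining the
  Whitney numbers.\<close>

lemma fps_nth_exp_mult_power:
  fixes b c :: "'a :: field_char_0"
  shows "(fps_exp b * (fps_exp c - 1) ^ k) $ n =
    (\<Sum>j=0..k. of_nat (k choose j) * (-1) ^ (k - j) * (c * of_nat j + b) ^ n) / fact n"
proof -
  have "fps_exp b * (fps_exp c - 1) ^ k =
      (\<Sum>j=0..k. fps_const (of_nat (k choose j) * (-1) ^ (k - j)) * fps_exp (c * of_nat j + b))"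
    unfolding diff_conv_add_uminus binomial_ring sum_distrib_left atLeast0AtMost
  proof (intro sum.cong refl)
    fix j
    have "(-1) ^ (k - j) = (fps_const ((-1) ^ (k - j)) :: 'a fps)"
      by (simp flip: fps_const_power fps_const_neg)
    thus "fps_exp b * (of_nat (k choose j) * fps_exp c ^ j * (- 1) ^ (k - j)) =
        fps_const (of_nat (k choose j) * (- 1) ^ (k - j)) * fps_exp (c * of_nat j + b)"
      by (simp add: fps_exp_power_mult fps_exp_add_mult mult_ac fps_of_nat[symmetric]
               flip: fps_const_mult)
  qed
  thus ?thesis
    by (simp add: fps_sum_nth sum_divide_distrib)
qed

lemma fps_nth_tanny_dowling:
  fixes a x :: real
  assumes "m > 0"
  shows "(fps_exp (- of_real a) / (1 - fps_const (of_real x / of_nat m) * (fps_exp (of_nat m) - 1))) $ n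
    = (of_real (noncentral_tanny_dowling m a n x) / fact n :: complex)"
proof -
  let ?E = "fps_exp (- of_real a) :: complex fps"
  let ?V = "fps_exp (of_nat m) - 1 :: complex fps"
  let ?c = "of_real x / of_nat m :: complex"
  have "(?E * (fps_const ?c * ?V) ^ k) $ n =
      of_real (fact k * noncentral_whitney2 m a n k * x ^ k) / fact n" for k
  proof -
    \<comment> \<open>The denominator \<open>m ^ k\<close> of the Whitney number comes from the
      scalar \<open>?c ^ k\<close>, while its \<open>fact k\<close> cancels.\<close>
    have "?E * (fps_const ?c * ?V) ^ k = fps_const (?c ^ k) * (?E * ?V ^ k)"
      by (simp only: power_mult_distrib fps_const_power mult_ac)
    hence "(?E * (fps_const ?c * ?V) ^ k) $ n = ?c ^ k * (?E * ?V ^ k) $ n"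
      by (simp only: fps_mult_left_const_nth)
    thus ?thesis
      using assms
      by (simp only: fps_nth_exp_mult_power)
         (simp add: noncentral_whitney2_def power_divide field_simps)
  qed
  thus ?thesis
    by (simp add: fps_nth_divide_one_minus noncentral_tanny_dowling_def atLeast0AtMost
        sum_divide_distrib)
qed

text \<open>The norm of the integrand is \<open>exp (- Re c * l)\<close>, which gives integrability;
  the value comes from an antiderivative that decays at infinity.\<close>

lemma
  fixes c :: complex
  assumes "Re c > 0"
  shows set_integrable_exp_neg_mult: "set_integrable lborel {0..} (\<lambda>l::real. exp (- of_real l * c))"
    and set_lebesgue_integral_exp_neg_mult: "(LINT l:{0..}|lborel. exp (- of_real l * c)) = 1 / c"
proof -
  let ?f = "\<lambda>l::real. exp (- of_real l * c)"
  let ?F = "\<lambda>l::real. - exp (- of_real l * c) / c"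
  have "c \<noteq> 0"
    using assms by auto
  have "(\<lambda>l::real. exp (- Re c * l)) absolutely_integrable_on {0..}"
    by (intro nonnegative_absolutely_integrable_1 integrable_on_exp_minus_to_infinity assms) simp
  hence "set_integrable lborel {0..} (\<lambda>l::real. exp (- Re c * l))"
    by (simp add: set_integrable_def integrable_completion)
  thus int: "set_integrable lborel {0..} ?f"
    by (rule set_integrable_bound)
       (auto simp: set_borel_measurable_def mult.commute
             intro!: borel_measurable_continuous_on_indicator continuous_intros)
  have "(?F \<longlongrightarrow> 0) at_top"
  proof (rule tendsto_norm_zero_cancel)
    have "((\<lambda>l. exp (- (Re c * l)) / norm c) \<longlongrightarrow> 0) at_top"
      using assms
      by (intro tendsto_divide_zero filterlim_compose[OF exp_at_bot]
            filterlim_compose[OF filterlim_uminus_at_bot_at_top]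
            filterlim_tendsto_pos_mult_at_top[OF tendsto_const] filterlim_ident)
    thus "((\<lambda>l. norm (?F l)) \<longlongrightarrow> 0) at_top"
      by (simp add: norm_divide mult.commute)
  qed
  hence lim_top: "((?F \<circ> real_of_ereal) \<longlongrightarrow> 0) (at_left \<infinity>)"
    unfolding ereal_tendsto_simps .
  have "(?F \<longlongrightarrow> ?F 0) (at_right 0)"
    using \<open>c \<noteq> 0\<close> by (intro tendsto_intros) auto
  hence lim_0: "((?F \<circ> real_of_ereal) \<longlongrightarrow> - 1 / c) (at_right (ereal 0))"
    unfolding ereal_tendsto_simps by simp
  have int': "set_integrable lborel {0<..} ?f"
    by (rule set_integrable_subset[OF int]) auto
  \<comment> \<open>The interval integral is taken over the open half-line, so the null set
    \<open>{0}\<close> is dropped first.\<close>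
  have "(LINT l:{0..}|lborel. ?f l) = (LINT l:{0<..}|lborel. ?f l)"
  proof -
    have "AE l in lborel. l \<noteq> (0::real)"
      by (rule AE_lborel_singleton)
    thus ?thesis
      unfolding set_lebesgue_integral_def
      by (intro integral_cong_AE) (auto simp: indicator_def elim!: eventually_mono)
  qed
  also have "\<dots> = (LBINT l=ereal 0..\<infinity>. ?f l)"
    by (simp add: interval_integral_to_infinity_eq)
  also have "\<dots> = 0 - (- 1 / c)"
  proof (rule interval_integral_FTC_integrable[where F = ?F])
    show "(?F has_vector_derivative ?f l) (at l)" for l
      using \<open>c \<noteq> 0\<close> by (auto intro!: derivative_eq_intros has_vector_derivative_real_field)
  qed (use int' lim_0 lim_top in auto)
  finally show "(LINT l:{0..}|lborel. ?f l) = 1 / c"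
    by simp
qed

theorem theorem7:
  fixes a x :: real and m :: nat
  assumes "m > 0"
  shows "\<exists>r>0. \<forall>z::complex. norm z < r \<longrightarrow>
    summable (\<lambda>n. of_real (noncentral_tanny_dowling m a n x) * z ^ n / fact n) \<and>
    set_integrable lborel {0..} (\<lambda>l::real.
      exp (- of_real a * z - of_real l * (1 - of_real x / of_nat m * (exp (of_nat m * z) - 1)))) \<and>
    (\<Sum>n. of_real (noncentral_tanny_dowling m a n x) * z ^ n / fact n) =
    (LINT l:{0..}|lborel.
      exp (- of_real a * z - of_real l * (1 - of_real x / of_nat m * (exp (of_nat m * z) - 1))))"
proof -
  define D where "D = (\<lambda>z::complex. 1 - of_real x / of_nat m * (exp (of_nat m * z) - 1))"
  define G :: "complex fps" where
    "G = fps_exp (- of_real a) / (1 - fps_const (of_real x / of_nat m) * (fps_exp (of_nat m) - 1))"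
  have coeff: "G $ n * z ^ n = of_real (noncentral_tanny_dowling m a n x) * z ^ n / fact n" for n z
    using fps_nth_tanny_dowling[OF assms, of a x n] by (simp add: G_def)
  \<comment> \<open>The denominator series has constant term 1, so the quotient is analytic at 0 and
    \<open>G\<close> has a positive radius of convergence.\<close>
  have "(\<lambda>z. exp (- of_real a * z) / D z) has_fps_expansion G"
    unfolding D_def G_def by (intro fps_expansion_intros) auto
  hence radius: "fps_conv_radius G > 0"
    and ev1: "\<forall>\<^sub>F z in nhds 0. eval_fps G z = exp (- of_real a * z) / D z"
    by (auto simp: has_fps_expansion_def)
  have ev2: "\<forall>\<^sub>F z in nhds 0. z \<in> eball 0 (fps_conv_radius G)"
    using radius by (intro eventually_nhds_in_open) (auto simp: zero_ereal_def)
  have "isCont (\<lambda>z. Re (D z)) 0"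
    unfolding D_def by (intro continuous_intros continuous_Re)
  hence "((\<lambda>z. Re (D z)) \<longlongrightarrow> Re (D 0)) (nhds 0)"
    by (simp add: isCont_def tendsto_nhds_iff)
  \<comment> \<open>Here \<open>D 0 = 1\<close>, so continuity keeps the real part positive near
    0.\<close>
  hence ev3: "\<forall>\<^sub>F z in nhds 0. Re (D z) > 0"
    by (rule order_tendstoD) (simp add: D_def)
  have "\<forall>\<^sub>F z in nhds 0. summable (\<lambda>n. G $ n * z ^ n) \<and>
      set_integrable lborel {0..} (\<lambda>l::real. exp (- of_real a * z - of_real l * D z)) \<and>
      (\<Sum>n. G $ n * z ^ n) =
      (LINT l:{0..}|lborel. exp (- of_real a * z - of_real l * D z))"
    using ev1 ev2 ev3
  proof eventually_elim
    case (elim z)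
    \<comment> \<open>The first factor is free of \<open>l\<close> and leaves the integral, which
      then equals \<open>exp (- of_real a * z) / D z\<close>.\<close>
    have split: "exp (- of_real a * z - of_real l * D z) =
        exp (- of_real a * z) * exp (- of_real l * D z)" for l :: real
      by (simp flip: exp_add)
    show ?case
      unfolding split
      using elim set_integrable_exp_neg_mult[of "D z"] set_lebesgue_integral_exp_neg_mult[of "D z"]
      by (simp add: summable_fps flip: eval_fps_def)
  qed
  thus ?thesis
    unfolding eventually_nhds_metric dist_norm D_def coeff by simp
qed

end
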